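(* Let $k\geq1$ be an integer, let $\kappa<\mathfrak{b}$ be a cardinal, and for each $\alpha<\kappa$ let $\mathcal{A}_\alpha$ be an almost disjoint family of infinite subsets of $\omega$ such that the $\Psi$-space $\Psi(\mathcal{A}_\alpha)$ is strongly $k$-star-Menger. Let $X=\bigcup_{\alpha<\kappa}\Psi(\mathcal{A}_\alpha)$ be the union of these spaces (all on the same set $\omega$), topologized so that points of $\omega$ are isolated and the basic neighbourhoods of a point $A\in\bigcup_{\alpha<\kappa}\mathcal{A}_\alpha$ are the sets $\{A\}\cup(A\setminus F)$ with $F$ a finite subset of $\omega$. Then $X$ is strongly $k$-star-Menger.
   Context: A family $\mathcal{A}$ of infinite subsets of $\omega$ is almost disjoint if any two distinct members have finite intersection. $\Psi(\mathcal{A})=\mathcal{A}\cup\omega$ with the topology in which points of $\omega$ are isolated and the basic neighbourhoods of $a\in\mathcal{A}$ are the sets $\{a\}\cup(a\setminus F)$ with $F\subseteq\omega$ finite. For a family $\mathcal{U}$ of subsets of $X$ and $A\subseteq X$, $St(A,\mathcal{U})=St^1(A,\mathcal{U})=\bigcup\{U\in\mathcal{U}:U\cap A\neq\emptyset\}$ and $St^{k+1}(A,\mathcal{U})=St(St^k(A,\mathcal{U}),\mathcal{U})$. A space $X$ is strongly $k$-star-Menger (also written $k$-strongly star-Menger) if for every sequence $\{\mathcal{U}_n:n\in\omega\}$ of open covers of $X$ there are finite sets $F_n\subseteq X$ such that $\{St^k(F_n,\mathcal{U}_n):n\in\omega\}$ covers $X$. $\mathfrak{b}$ is the least cardinality of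 a subset of $\omega^\omega$ that is unbounded with respect to $\leq^*$, where $f\leq^* g$ means $f(n)\leq g(n)$ for all but finitely many $n$. *)

theory Defs
  imports "HOL-Analysis.Abstract_Topology"
begin

unbundle cardinal_syntax

section \<open>The bounding number\<close>

definition le_star :: "(nat \<Rightarrow> nat) \<Rightarrow> (nat \<Rightarrow> nat) \<Rightarrow> bool" (infix \<open>\<le>*\<close> 50)
  where "f \<le>* g \<longleftrightarrow> (\<forall>\<^sub>F n in cofinite. f n \<le> g n)"

definition unbounded_star :: "(nat \<Rightarrow> nat) set \<Rightarrow> bool"
  where "unbounded_star B \<longleftrightarrow> \<not> (\<exists>g. \<forall>f\<in>B. f \<le>* g)"

text \<open>
  Cardinals are the cardinal orders of the library, which are determined only up to order
  isomorphism, so the least one is obtained by choice. Existence is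
  \<open>ex_least_unbounded_star\<close>.
\<close>

definition bounding_number :: "(nat \<Rightarrow> nat) rel" (\<open>\<bb>\<close>)
  where "\<bb> = (SOME r. \<exists>B. unbounded_star B \<and> r = |B| \<and> (\<forall>C. unbounded_star C \<longrightarrow> |B| \<le>o |C| ))"

lemma unbounded_star_UNIV: "unbounded_star UNIV"
proof -
  have "\<not> (\<lambda>n. Suc (g n)) \<le>* g" for g
    by (simp add: le_star_def eventually_cofinite)
  then show ?thesis
    unfolding unbounded_star_def by blast
qed

lemma ex_least_unbounded_star:
  "\<exists>B. unbounded_star B \<and> (\<forall>C. unbounded_star C \<longrightarrow> |B| \<le>o |C| )"
proof -
  let ?R = "card_of ` Collect unbounded_star"
  have "?R \<noteq> {}" using unbounded_star_UNIV by blast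
  moreover have "\<forall>r\<in>?R. Card_order r" by (auto simp: card_of_Card_order)
  ultimately obtain r where "r \<in> ?R" "\<forall>r'\<in>?R. r \<le>o r'"
    using exists_minim_Card_order by metis
  then show ?thesis by auto
qed

lemma bounding_number_witness:
  "\<exists>B. unbounded_star B \<and> \<bb> = |B| \<and> (\<forall>C. unbounded_star C \<longrightarrow> |B| \<le>o |C| )"
  unfolding bounding_number_def
  by (rule someI_ex) (use ex_least_unbounded_star in blast)


section \<open>Spaces of \<open>\<Psi>\<close>-type\<close>

definition almost_disjoint :: "nat set set \<Rightarrow> bool"
  where "almost_disjoint \<A> \<longleftrightarrow> (\<forall>a\<in>\<A>. infinite a) \<and> pairwise (\<lambda>a b. finite (a \<inter> b)) \<A>"

text \<open>
  The point \<open>n\<close> of \<open>\<omega>\<close> is \<open>Inl n\<close> and the point \<open>a\<close> of the family is \<open>Inr a\<close>.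
\<close>

type_synonym psi_point = "nat + nat set"

definition psi_points :: "nat set set \<Rightarrow> psi_point set"
  where "psi_points \<A> = range Inl \<union> Inr ` \<A>"

definition psi_nbhd :: "nat set \<Rightarrow> nat set \<Rightarrow> psi_point set"
  where "psi_nbhd a F = insert (Inr a) (Inl ` (a - F))"

text \<open>
  The topology on a set \<open>S\<close> of points for which the points of \<open>\<omega>\<close> are isolated and
  the sets \<open>psi_nbhd a F\<close> with \<open>F\<close> finite are the basic neighbourhoods of \<open>Inr a\<close>.
  It is defined on an arbitrary \<open>S\<close> so that it serves both for one \<open>\<Psi>\<close>-space and for the
  union of an indexed family of them; that union is empty when the index set is.
\<close>

definition psi_topology :: "psi_point set \<Rightarrow> psi_point topology"
  where "psi_topology S =
    topology (\<lambda>U. U \<subseteq> S \<and> (\<forall>a. Inr a \<in> U \<longrightarrow> (\<exists>F. finite F \<and> psi_nbhd a F \<subseteq> U)))"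

definition Psi_space :: "nat set set \<Rightarrow> psi_point topology" (\<open>\<Psi>\<close>)
  where "\<Psi> \<A> = psi_topology (psi_points \<A>)"

lemma openin_psi_topology:
  "openin (psi_topology S) U \<longleftrightarrow>
    U \<subseteq> S \<and> (\<forall>a. Inr a \<in> U \<longrightarrow> (\<exists>F. finite F \<and> psi_nbhd a F \<subseteq> U))"
proof -
  let ?L = "\<lambda>U. U \<subseteq> S \<and> (\<forall>a. Inr a \<in> U \<longrightarrow> (\<exists>F. finite F \<and> psi_nbhd a F \<subseteq> U))"
  have "?L (U \<inter> V)" if U: "?L U" and V: "?L V" for U V
  proof -
    have "\<exists>F. finite F \<and> psi_nbhd a F \<subseteq> U \<inter> V" if a: "Inr a \<in> U \<inter> V" for a
    proof -
      obtain F G where "finite F" "psi_nbhd a F \<subseteq> U" "finite G" "psi_nbhd a G \<subseteq> V"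
        using a U V by blast
      then have "finite (F \<union> G)" "psi_nbhd a (F \<union> G) \<subseteq> U \<inter> V"
        by (auto simp: psi_nbhd_def)
      then show ?thesis by blast
    qed
    with U show ?thesis by blast
  qed
  moreover have "?L (\<Union>\<K>)" if "\<forall>K\<in>\<K>. ?L K" for \<K>
    using that by (meson Sup_least Union_iff Union_upper order_trans)
  ultimately have "istopology ?L"
    unfolding istopology_def by blast
  then show ?thesis
    by (simp add: psi_topology_def)
qed

lemma openin_Psi_space_nat: "openin (\<Psi> \<A>) {Inl n}"
  by (auto simp: Psi_space_def openin_psi_topology psi_points_def)

lemma openin_Psi_space_nbhd: "a \<in> \<A> \<Longrightarrow> finite F \<Longrightarrow> openin (\<Psi> \<A>) (psi_nbhd a F)"
  by (auto simp: Psi_space_def openin_psi_topology psi_points_def psi_nbhd_def)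

lemma topspace_Psi_space: "topspace (\<Psi> \<A>) = psi_points \<A>"
proof
  show "topspace (\<Psi> \<A>) \<subseteq> psi_points \<A>"
    using openin_topspace[of "\<Psi> \<A>"] unfolding Psi_space_def openin_psi_topology by blast
  have "openin (\<Psi> \<A>) (psi_points \<A>)"
    unfolding Psi_space_def openin_psi_topology
    by (auto simp: psi_points_def psi_nbhd_def)
  then show "psi_points \<A> \<subseteq> topspace (\<Psi> \<A>)"
    by (rule openin_subset)
qed


section \<open>Strongly \<open>k\<close>-star-Menger spaces\<close>

definition star :: "'a set set \<Rightarrow> 'a set \<Rightarrow> 'a set"
  where "star \<U> A = \<Union>{U \<in> \<U>. U \<inter> A \<noteq> {}}"

definition iter_star :: "nat \<Rightarrow> 'a set set \<Rightarrow> 'a set \<Rightarrow> 'a set"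
  where "iter_star k \<U> A = (star \<U> ^^ k) A"

definition open_cover :: "'a topology \<Rightarrow> 'a set set \<Rightarrow> bool"
  where "open_cover X \<U> \<longleftrightarrow> (\<forall>U\<in>\<U>. openin X U) \<and> \<Union>\<U> = topspace X"

definition strongly_star_Menger :: "nat \<Rightarrow> 'a topology \<Rightarrow> bool"
  where "strongly_star_Menger k X \<longleftrightarrow>
    (\<forall>\<U> :: nat \<Rightarrow> 'a set set. (\<forall>n. open_cover X (\<U> n)) \<longrightarrow>
      (\<exists>F :: nat \<Rightarrow> 'a set. (\<forall>n. finite (F n) \<and> F n \<subseteq> topspace X) \<and>
        topspace X \<subseteq> (\<Union>n. iter_star k (\<U> n) (F n))))"

end

theory Submission
  imports Defs "HOL-Library.Nat_Bijection"
begin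

text \<open>
  Fix open covers \<open>\<U> n\<close> of the union. For a single family \<open>\<A>\<close>, every point \<open>Inr a\<close> has a basic
  neighbourhood inside a member of \<open>\<U> n\<close>; these neighbourhoods and the singletons of \<open>\<omega>\<close> form a
  refinement of \<open>\<U> n\<close> in which \<open>Inr a\<close> lies in just one member. The star of \<open>Inr a\<close> is then that
  member, so it is contained in the star of any of the isolated points belonging to it. Hence the
  finite sets provided by the hypothesis on \<open>\<Psi> \<A>\<close> can be replaced by initial segments of \<open>\<omega>\<close>,
  and these are described by one function \<open>f\<close>, where \<open>f n\<close> is the length of the \<open>n\<close>-th segment.

  This yields fewer than \<open>\<bb>\<close> functions, one for each family, so a single \<open>g\<close> eventually dominates
  all of them, and the segments of length \<open>g n\<close> should work for the whole union. Domination fails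
  at finitely many \<open>n\<close>, so every point has to be captured infinitely often; splitting \<open>\<omega>\<close> into
  infinitely many infinite pieces and using the hypothesis on each piece achieves this
  (lemmas \<open>strongly_star_Menger_frequently\<close> and \<open>Psi_space_captured_by_segments\<close>).
\<close>

lemma star_mono:
  assumes "\<And>V. V \<in> \<V> \<Longrightarrow> \<exists>U\<in>\<U>. V \<subseteq> U" and "A \<subseteq> B"
  shows "star \<V> A \<subseteq> star \<U> B"
proof
  fix x assume "x \<in> star \<V> A"
  then obtain V where "V \<in> \<V>" "V \<inter> A \<noteq> {}" "x \<in> V"
    by (auto simp: star_def)
  moreover obtain U where "U \<in> \<U>" "V \<subseteq> U"
    using assms(1) \<open>V \<in> \<V>\<close> by blast
  ultimately show "x \<in> star \<U> B"
    using assms(2) unfolding star_def by blast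
qed

lemma iter_star_mono:
  assumes "\<And>V. V \<in> \<V> \<Longrightarrow> \<exists>U\<in>\<U>. V \<subseteq> U" and "A \<subseteq> B"
  shows "iter_star k \<V> A \<subseteq> iter_star k \<U> B"
  unfolding iter_star_def
proof (induction k)
  case (Suc k)
  then show ?case
    using star_mono[OF assms(1)] by simp
qed (use assms(2) in simp)

lemma iter_star_Suc: "iter_star (Suc k) \<U> A = iter_star k \<U> (star \<U> A)"
  by (simp add: iter_star_def funpow_Suc_right del: funpow.simps)

text \<open>
  Apply the selection property to each row of the array \<open>\<U> (prod_encode (j, i))\<close>: a point is then
  captured once in every row, hence infinitely often altogether.
\<close>

lemma strongly_star_Menger_frequently:
  fixes \<U> :: "nat \<Rightarrow> 'a set set"
  assumes X: "strongly_star_Menger k X" and \<U>: "\<And>n. open_cover X (\<U> n)"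
  obtains F where "\<And>n. finite (F n)" "\<And>n. F n \<subseteq> topspace X"
    "\<And>x. x \<in> topspace X \<Longrightarrow> \<exists>\<^sub>\<infinity>n. x \<in> iter_star k (\<U> n) (F n)"
proof -
  have "\<exists>F. (\<forall>i. finite (F i) \<and> F i \<subseteq> topspace X) \<and>
      topspace X \<subseteq> (\<Union>i. iter_star k (\<U> (prod_encode (j, i))) (F i))" for j
    using X[unfolded strongly_star_Menger_def, rule_format, of "\<lambda>i. \<U> (prod_encode (j, i))"] \<U>
    by blast
  then obtain F where F: "\<And>j i. finite (F j i) \<and> F j i \<subseteq> topspace X"
    and cov: "\<And>j. topspace X \<subseteq> (\<Union>i. iter_star k (\<U> (prod_encode (j, i))) (F j i))"
    by metis
  define G where "G n = case_prod F (prod_decode n)" for n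
  show thesis
  proof
    show "finite (G n)" "G n \<subseteq> topspace X" for n
      using F by (auto simp: G_def split: prod.split)
    fix x assume "x \<in> topspace X"
    then have "\<exists>i. x \<in> iter_star k (\<U> (prod_encode (j, i))) (F j i)" for j
      using cov by blast
    then obtain i where i: "\<And>j. x \<in> iter_star k (\<U> (prod_encode (j, i j))) (F j (i j))"
      by metis
    let ?enc = "\<lambda>j. prod_encode (j, i j)"
    have inf: "infinite (range ?enc)"
      by (rule range_inj_infinite) (auto intro: injI)
    have "range ?enc \<subseteq> {n. x \<in> iter_star k (\<U> n) (G n)}"
      using i by (auto simp: G_def)
    from infinite_super[OF this inf] show "\<exists>\<^sub>\<infinity>n. x \<in> iter_star k (\<U> n) (G n)"
      unfolding frequently_cofinite .
  qed
qed

definition thin_cover :: "nat set set \<Rightarrow> (nat set \<Rightarrow> nat set) \<Rightarrow> psi_point set set"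
  where "thin_cover \<A> \<phi> = range (\<lambda>m. {Inl m}) \<union> (\<lambda>a. psi_nbhd a (\<phi> a)) ` \<A>"

lemma open_cover_thin_cover:
  assumes "\<And>a. a \<in> \<A> \<Longrightarrow> finite (\<phi> a)"
  shows "open_cover (\<Psi> \<A>) (thin_cover \<A> \<phi>)"
proof -
  have "\<Union>(thin_cover \<A> \<phi>) = psi_points \<A>"
    by (auto simp: thin_cover_def psi_points_def psi_nbhd_def)
  then show ?thesis
    using assms
    by (auto simp: open_cover_def thin_cover_def topspace_Psi_space
        intro: openin_Psi_space_nat openin_Psi_space_nbhd)
qed

text \<open>
  The only member of a thin cover containing \<open>Inr a\<close> also contains isolated points, because
  \<open>a - \<phi> a\<close> is infinite; one of them can stand in for \<open>Inr a\<close>.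
\<close>

lemma star_thin_cover_segment:
  assumes inf: "\<And>a. a \<in> \<A> \<Longrightarrow> infinite a" and fin: "\<And>a. a \<in> \<A> \<Longrightarrow> finite (\<phi> a)"
    and F: "finite F" "F \<subseteq> psi_points \<A>"
  shows "\<exists>l. star (thin_cover \<A> \<phi>) F \<subseteq> star (thin_cover \<A> \<phi>) (Inl ` {..<l})"
proof -
  have "\<exists>m. \<forall>V\<in>thin_cover \<A> \<phi>. x \<in> V \<longrightarrow> Inl m \<in> V" if "x \<in> F" for x
  proof (cases x)
    case (Inl m)
    then show ?thesis by blast
  next
    case (Inr a)
    then have "a \<in> \<A>"
      using that F by (auto simp: psi_points_def)
    then have "infinite (a - \<phi> a)"
      using inf fin by simp
    then obtain m where "m \<in> a - \<phi> a"
      using infinite_imp_nonempty by blast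
    then show ?thesis
      using Inr by (auto simp: thin_cover_def psi_nbhd_def)
  qed
  then obtain r where r: "\<And>x V. x \<in> F \<Longrightarrow> V \<in> thin_cover \<A> \<phi> \<Longrightarrow> x \<in> V \<Longrightarrow> Inl (r x) \<in> V"
    by metis
  obtain l where l: "\<And>x. x \<in> F \<Longrightarrow> r x < l"
    using F(1) finite_nat_set_iff_bounded[of "r ` F"] by auto
  have "V \<inter> Inl ` {..<l} \<noteq> {}" if V: "V \<in> thin_cover \<A> \<phi>" "V \<inter> F \<noteq> {}" for V
  proof -
    obtain x where "x \<in> F" "x \<in> V"
      using V(2) by blast
    then have "Inl (r x) \<in> V \<inter> Inl ` {..<l}"
      using r V(1) l by simp
    then show ?thesis by blast
  qed
  then have "star (thin_cover \<A> \<phi>) F \<subseteq> star (thin_cover \<A> \<phi>) (Inl ` {..<l})"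
    unfolding star_def by (intro Union_mono Collect_mono) simp
  then show ?thesis ..
qed

text \<open>
  The hypotheses on \<open>\<U> n\<close> are phrased by basic neighbourhoods so that open covers of a larger space
  of \<open>\<Psi>\<close>-type satisfy them without passing to traces.
\<close>

lemma Psi_space_captured_by_segments:
  fixes \<U> :: "nat \<Rightarrow> psi_point set set"
  assumes "k \<ge> 1" and inf: "\<And>a. a \<in> \<A> \<Longrightarrow> infinite a"
    and Menger: "strongly_star_Menger k (\<Psi> \<A>)"
    and nat: "\<And>n m. Inl m \<in> \<Union>(\<U> n)"
    and nbhd: "\<And>n a. a \<in> \<A> \<Longrightarrow> \<exists>U\<in>\<U> n. \<exists>F. finite F \<and> psi_nbhd a F \<subseteq> U"
  shows "\<exists>f. \<forall>x\<in>psi_points \<A>. \<exists>\<^sub>\<infinity>n. x \<in> iter_star k (\<U> n) (Inl ` {..<f n})"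
proof -
  define \<phi> where "\<phi> n a = (SOME F. finite F \<and> (\<exists>U\<in>\<U> n. psi_nbhd a F \<subseteq> U))" for n a
  have \<phi>: "finite (\<phi> n a) \<and> (\<exists>U\<in>\<U> n. psi_nbhd a (\<phi> n a) \<subseteq> U)" if "a \<in> \<A>" for n a
    unfolding \<phi>_def by (rule someI_ex) (use nbhd[OF that, of n] in blast)
  then have fin: "\<And>n a. a \<in> \<A> \<Longrightarrow> finite (\<phi> n a)"
    by simp
  let ?\<V> = "\<lambda>n. thin_cover \<A> (\<phi> n)"
  have refines: "\<exists>U\<in>\<U> n. V \<subseteq> U" if V: "V \<in> ?\<V> n" for n V
  proof -
    consider m where "V = {Inl m}" | a where "a \<in> \<A>" "V = psi_nbhd a (\<phi> n a)"
      using V by (auto simp: thin_cover_def)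
    then show ?thesis
    proof cases
      case 1
      then show ?thesis using nat[of m n] by auto
    next
      case 2
      then show ?thesis using \<phi> by simp
    qed
  qed
  have "open_cover (\<Psi> \<A>) (?\<V> n)" for n
    using fin by (rule open_cover_thin_cover)
  then obtain F where F: "\<And>n. finite (F n)" "\<And>n. F n \<subseteq> psi_points \<A>"
    and freq: "\<And>x. x \<in> psi_points \<A> \<Longrightarrow> \<exists>\<^sub>\<infinity>n. x \<in> iter_star k (?\<V> n) (F n)"
    by (rule strongly_star_Menger_frequently[OF Menger, of ?\<V>, unfolded topspace_Psi_space])
      blast
  have "\<exists>l. star (?\<V> n) (F n) \<subseteq> star (?\<V> n) (Inl ` {..<l})" for n
    using inf fin F by (rule star_thin_cover_segment)
  then obtain f where f: "\<And>n. star (?\<V> n) (F n) \<subseteq> star (?\<V> n) (Inl ` {..<f n})"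
    by metis
  obtain k' where k: "k = Suc k'"
    using \<open>k \<ge> 1\<close> by (cases k) auto
  \<comment> \<open>Since \<open>k \<ge> 1\<close>, there is an innermost star, and it is there that the finite sets are exchanged
    for segments; the thin covers give way to the \<open>\<U> n\<close> only afterwards.\<close>
  have sub: "iter_star k (?\<V> n) (F n) \<subseteq> iter_star k (\<U> n) (Inl ` {..<f n})" for n
  proof -
    have "iter_star k (?\<V> n) (F n) \<subseteq> iter_star k (?\<V> n) (Inl ` {..<f n})"
      unfolding k iter_star_Suc using f[of n] by (intro iter_star_mono) blast+
    also have "\<dots> \<subseteq> iter_star k (\<U> n) (Inl ` {..<f n})"
      by (rule iter_star_mono[OF refines]) simp_all
    finally show ?thesis .
  qed
  have "\<exists>\<^sub>\<infinity>n. x \<in> iter_star k (\<U> n) (Inl ` {..<f n})" if "x \<in> psi_points \<A>" for x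
    using freq[OF that] by (rule frequently_elim1) (rule subsetD[OF sub])
  then show ?thesis
    by blast
qed

lemma bounded_of_card_less_bounding_number:
  assumes "|I| <o \<bb>"
  shows "\<exists>g. \<forall>i\<in>I. f i \<le>* g"
proof -
  have "|f ` I| <o \<bb>"
    using card_of_image assms by (rule ordLeq_ordLess_trans)
  moreover have "\<bb> \<le>o |C|" if "unbounded_star C" for C
    using bounding_number_witness that by auto
  ultimately have "\<not> unbounded_star (f ` I)"
    using not_ordLess_ordLeq by blast
  then show ?thesis
    by (auto simp: unbounded_star_def)
qed

theorem theorem4p8:
  fixes k :: nat
    and \<kappa> :: "'i rel"
    and \<A> :: "'i \<Rightarrow> nat set set"
  assumes "k \<ge> 1"
    and "Card_order \<kappa>"
    and "\<kappa> <o \<bb>"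
    and "\<And>\<alpha>. \<alpha> \<in> Field \<kappa> \<Longrightarrow> almost_disjoint (\<A> \<alpha>)"
    and "\<And>\<alpha>. \<alpha> \<in> Field \<kappa> \<Longrightarrow> strongly_star_Menger k (\<Psi> (\<A> \<alpha>))"
  shows "strongly_star_Menger k (psi_topology (\<Union>\<alpha>\<in>Field \<kappa>. topspace (\<Psi> (\<A> \<alpha>))))"
proof -
  let ?S = "\<Union>\<alpha>\<in>Field \<kappa>. topspace (\<Psi> (\<A> \<alpha>))"
  let ?X = "psi_topology ?S"
  have S: "?S = (\<Union>\<alpha>\<in>Field \<kappa>. psi_points (\<A> \<alpha>))"
    by (simp add: topspace_Psi_space)
  have "openin ?X ?S"
    unfolding openin_psi_topology S by (auto simp: psi_points_def psi_nbhd_def)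
  then have top: "topspace ?X = ?S"
    using openin_subset openin_topspace[of ?X, unfolded openin_psi_topology] by blast
  show ?thesis
    unfolding strongly_star_Menger_def
  proof (intro allI impI)
    fix \<U> :: "nat \<Rightarrow> psi_point set set"
    assume "\<forall>n. open_cover ?X (\<U> n)"
    then have op: "\<And>n U. U \<in> \<U> n \<Longrightarrow> openin ?X U" and un: "\<And>n. \<Union>(\<U> n) = ?S"
      unfolding open_cover_def top by blast+
    have "\<exists>f. \<forall>x\<in>psi_points (\<A> \<alpha>). \<exists>\<^sub>\<infinity>n. x \<in> iter_star k (\<U> n) (Inl ` {..<f n})"
      if \<alpha>: "\<alpha> \<in> Field \<kappa>" for \<alpha>
    proof (rule Psi_space_captured_by_segments[OF assms(1) _ assms(5)[OF \<alpha>]])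
      show "infinite a" if "a \<in> \<A> \<alpha>" for a
        using assms(4)[OF \<alpha>] that by (simp add: almost_disjoint_def)
      show "Inl m \<in> \<Union>(\<U> n)" for n m
        unfolding un S using \<alpha> by (auto simp: psi_points_def)
      show "\<exists>U\<in>\<U> n. \<exists>F. finite F \<and> psi_nbhd a F \<subseteq> U" if "a \<in> \<A> \<alpha>" for n a
      proof -
        have "Inr a \<in> \<Union>(\<U> n)"
          unfolding un S using \<alpha> that by (auto simp: psi_points_def)
        then obtain U where "U \<in> \<U> n" "Inr a \<in> U" by blast
        moreover have "openin ?X U"
          using op \<open>U \<in> \<U> n\<close> .
        ultimately show ?thesis
          unfolding openin_psi_topology by blast
      qed
    qed
    then obtain f where f: "\<And>\<alpha> x. \<alpha> \<in> Field \<kappa> \<Longrightarrow> x \<in> psi_points (\<A> \<alpha>) \<Longrightarrow>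
        \<exists>\<^sub>\<infinity>n. x \<in> iter_star k (\<U> n) (Inl ` {..<f \<alpha> n})"
      by metis
    have "|Field \<kappa>| <o \<bb>"
      using card_of_Field_ordIso[OF assms(2)] assms(3) by (rule ordIso_ordLess_trans)
    then obtain g where g: "\<And>\<alpha>. \<alpha> \<in> Field \<kappa> \<Longrightarrow> f \<alpha> \<le>* g"
      using bounded_of_card_less_bounding_number by metis
    \<comment> \<open>The intersection with \<open>?S\<close> matters only for an empty index set, whose union contains no
      point of \<open>\<omega>\<close>.\<close>
    let ?F = "\<lambda>n. Inl ` {..<g n} \<inter> ?S"
    show "\<exists>F. (\<forall>n. finite (F n) \<and> F n \<subseteq> topspace ?X) \<and>
        topspace ?X \<subseteq> (\<Union>n. iter_star k (\<U> n) (F n))"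
    proof (intro exI[of _ ?F] conjI allI subsetI)
      fix x assume "x \<in> topspace ?X"
      then have "x \<in> ?S"
        unfolding top .
      then obtain \<alpha> where \<alpha>: "\<alpha> \<in> Field \<kappa>" "x \<in> psi_points (\<A> \<alpha>)"
        unfolding S by blast
      have "\<exists>\<^sub>\<infinity>n. x \<in> iter_star k (\<U> n) (Inl ` {..<f \<alpha> n}) \<and> f \<alpha> n \<le> g n"
        using g[OF \<alpha>(1)]
        by (intro frequently_rev_mp[OF f[OF \<alpha>]]) (auto simp: le_star_def elim: eventually_mono)
      then obtain n where n: "x \<in> iter_star k (\<U> n) (Inl ` {..<f \<alpha> n})" "f \<alpha> n \<le> g n"
        using frequently_ex by blast
      have "Inl ` {..<f \<alpha> n} \<subseteq> ?F n"
        unfolding S using n(2) \<alpha>(1) by (auto simp: psi_points_def)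
      then have "iter_star k (\<U> n) (Inl ` {..<f \<alpha> n}) \<subseteq> iter_star k (\<U> n) (?F n)"
        by (intro iter_star_mono) blast+
      with n(1) show "x \<in> (\<Union>n. iter_star k (\<U> n) (?F n))"
        by blast
    qed (auto simp: top)
  qed
qed

end
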